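(* For every integer $m\ge0$, $$\sum_{n=0}^{\infty}\frac{1}{64^n}\binom{2n}{n}\binom{4n}{2n}\frac{1}{n+m+1}=\frac{16\sqrt2\;64^m}{\pi(2m+1)(4m+3)\binom{2m}{m}\binom{4m+2}{2m+1}}\sum_{j=0}^{m}\frac{1}{64^j}\binom{2j}{j}\binom{4j}{2j}.$$ *)

theory Defs
  imports Complex_Main
begin

end

theory Submission imports Defs "HOL-Analysis.Gamma_Function" "HOL-Real_Asymp.Real_Asymp"
begin

text \<open>
  Put \<open>a n = binom(2n, n) binom(4n, 2n) / 64^n\<close>. These are the Taylor coefficients of the
  hypergeometric function \<open>2F1(1/4, 3/4; 1; x)\<close>, that is,
  \<open>(n+1)^2 a (n+1) = (n+1/4) (n+3/4) a n\<close>, and the left-hand side \<open>S m\<close> is the moment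
  \<open>\<integral> x^m 2F1(1/4, 3/4; 1; x) dx\<close> over \<open>[0,1]\<close>. Integrating the hypergeometric differential
  equation by parts relates two consecutive moments,
  \<open>(m+1/4) (m+3/4) S m = m^2 S (m-1) + c\<close>, with a boundary term \<open>c\<close> that does not depend
  on \<open>m\<close>.

  In terms of series no integral is needed: with \<open>T n = n^2 a n / (n+m)\<close>, the recurrence of \<open>a\<close>
  gives
  \<open>T (n+1) - T n = (m+1/4) (m+3/4) a n / (n+m+1) - m^2 a n / (n+m)\<close>, so that the relation between
  moments comes from telescoping (lemma \<open>hyp_moment_telescope\<close>), and \<open>c\<close> is the limit of
  \<open>T n\<close>, hence of \<open>n * a n\<close>. The Euler product for the Gamma function and the reflection formula
  identify it as \<open>1 / (\<Gamma>(1/4) \<Gamma>(3/4)) = 1 / (pi sqrt 2)\<close> (lemma \<open>hyp_coeff_LIMSEQ\<close>).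

  At \<open>m = 0\<close> the term with \<open>S (m-1)\<close> vanishes, so the relation determines every moment.
  Since \<open>m^2 a m = (m-3/4) (m-1/4) a (m-1)\<close>, it says that
  \<open>(m+1/4) (m+3/4) a m S m / c\<close> grows by exactly \<open>a m\<close> from \<open>m-1\<close> to \<open>m\<close>; it is therefore the
  partial sum of \<open>a\<close> up to \<open>m\<close>. The prefactor in the theorem is
  \<open>c / ((m+1/4) (m+3/4) a m)\<close> written in binomial coefficients.
\<close>

definition hyp_coeff :: "nat \<Rightarrow> real" where
  "hyp_coeff n = 1 / 64 ^ n * real ((2*n) choose n) * real ((4*n) choose (2*n))"

lemma hyp_coeff_0 [simp]: "hyp_coeff 0 = 1"
  by (simp add: hyp_coeff_def)

lemma hyp_coeff_pos: "hyp_coeff n > 0"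
  by (simp add: hyp_coeff_def)

lemma central_binomial_Suc:
  "real ((2 * Suc k) choose Suc k) = 2 * (2 * real k + 1) / (real k + 1) * real ((2*k) choose k)"
proof -
  have central: "real ((2*j) choose j) = fact (2*j) / (fact j)\<^sup>2" for j
    by (simp add: binomial_fact power2_eq_square)
  have "fact (2 * Suc k) = (2 * real k + 2) * (2 * real k + 1) * fact (2*k)"
    by (simp add: algebra_simps)
  then have "real ((2 * Suc k) choose Suc k)
      = (2 * real k + 2) * (2 * real k + 1) * fact (2*k) / ((real k + 1) * fact k)\<^sup>2"
    unfolding central by (simp add: add_ac)
  also have "\<dots> = 2 * (2 * real k + 1) / (real k + 1) * (fact (2*k) / (fact k)\<^sup>2)"
    by (simp add: divide_simps power2_eq_square) (simp add: algebra_simps)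
  finally show ?thesis
    unfolding central .
qed

lemma hyp_coeff_Suc:
  "(real n + 1)\<^sup>2 * hyp_coeff (Suc n) = (real n + 1/4) * (real n + 3/4) * hyp_coeff n"
proof -
  have four_n: "real ((4 * Suc n) choose (2 * Suc n))
          = 2 * (4 * real n + 3) / (2 * real n + 2) *
            (2 * (4 * real n + 1) / (2 * real n + 1) * real ((4*n) choose (2*n)))"
  proof -
    have eqs: "4 * Suc n = 2 * Suc (Suc (2*n))" "2 * Suc n = Suc (Suc (2*n))"
      by simp_all
    show ?thesis
      unfolding eqs central_binomial_Suc by (simp add: add_ac)
  qed
  have pos: "real n + 1 \<noteq> 0" "2 * real n + 1 \<noteq> 0" "2 * real n + 2 \<noteq> 0"
    by linarith+
  show ?thesis
    unfolding hyp_coeff_def four_n central_binomial_Suc[of n] using pos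
    by (simp add: divide_simps power2_eq_square) (simp add: algebra_simps)
qed

lemma hyp_coeff_pochhammer:
  "hyp_coeff n = pochhammer (1/4) n * pochhammer (3/4) n / (fact n)\<^sup>2"
proof (induction n)
  case 0
  then show ?case by simp
next
  case (Suc n)
  have "hyp_coeff (Suc n) = (real n + 1/4) * (real n + 3/4) * hyp_coeff n / (real n + 1)\<^sup>2"
    using hyp_coeff_Suc[of n] by (simp add: field_simps)
  also have "\<dots> = pochhammer (1/4) (Suc n) * pochhammer (3/4) (Suc n) / (fact (Suc n))\<^sup>2"
    unfolding Suc.IH by (simp add: pochhammer_Suc power_mult_distrib add_ac mult_ac)
  finally show ?case .
qed

lemma rGamma_quarters: "rGamma (1/4) * rGamma (3/4) = 1 / (pi * sqrt 2)"
proof -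
  have "complex_of_real (rGamma (1/4) * rGamma (3/4)) = rGamma (1/4) * rGamma (1 - 1/4)"
    by (simp flip: rGamma_complex_of_real)
  also have "\<dots> = complex_of_real (sin (pi/4) / pi)"
    by (subst rGamma_reflection_complex) (simp flip: sin_of_real)
  finally have "rGamma (1/4) * rGamma (3/4) = sin (pi/4) / pi"
    by (simp only: of_real_eq_iff)
  also have "\<dots> = 1 / (pi * sqrt 2)"
    by (simp add: sin_45 divide_simps)
  finally show ?thesis .
qed

text \<open>
  The product of the Euler approximations to \<open>1 / \<Gamma>(1/4)\<close> and \<open>1 / \<Gamma>(3/4)\<close> carries the powers
  \<open>n powr (1/4)\<close> and \<open>n powr (3/4)\<close>, whose product is \<open>n\<close>. Since these approximations use
  Pochhammer symbols of length \<open>n + 1\<close>, the extra factor \<open>(n+1/4) (n+3/4)\<close> comes with them.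
\<close>
lemma hyp_coeff_LIMSEQ:
  "(\<lambda>n. (real n + 1/4) * (real n + 3/4) * hyp_coeff n / real n) \<longlonglongrightarrow> 1 / (pi * sqrt 2)"
proof (rule Lim_transform_eventually)
  show "(\<lambda>n. rGamma_series (1/4) n * rGamma_series (3/4) n) \<longlonglongrightarrow> 1 / (pi * sqrt 2)"
    unfolding rGamma_quarters [symmetric] by (intro tendsto_intros)
  show "\<forall>\<^sub>F n in sequentially. rGamma_series (1/4) n * rGamma_series (3/4) n
          = (real n + 1/4) * (real n + 3/4) * hyp_coeff n / real n"
    using eventually_gt_at_top[of 0]
  proof eventually_elim
    case (elim n)
    have "exp (1/4 * ln (real n)) * exp (3/4 * ln (real n)) = real n"
      using elim by (simp flip: exp_add)
    then have "rGamma_series (1/4) n * rGamma_series (3/4) n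
                 = pochhammer (1/4) (Suc n) * pochhammer (3/4) (Suc n) / ((fact n)\<^sup>2 * real n)"
      by (simp add: rGamma_series_def power2_eq_square mult_ac)
    then show ?case
      by (simp add: hyp_coeff_pochhammer pochhammer_Suc add_ac mult_ac)
  qed
qed

text \<open>
  Polynomial division by the linear denominators produces the same quotient \<open>n - m\<close> twice:
  \<open>(n+1/4) (n+3/4) / (n+m+1) = n - m + (m+1/4) (m+3/4) / (n+m+1)\<close> and
  \<open>n^2 / (n+m) = n - m + m^2 / (n+m)\<close>. So the difference of the two terms only keeps the remainders.
  The case \<open>n = m = 0\<close> holds because division by zero yields zero.
\<close>
lemma hyp_moment_telescope:
  fixes m n :: nat
  defines "T \<equiv> \<lambda>n. (real n)\<^sup>2 * hyp_coeff n / (real n + real m)"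
  shows "T (Suc n) - T n
           = (real m + 1/4) * (real m + 3/4) * (hyp_coeff n * (1 / (real n + real m + 1)))
             - (real m)\<^sup>2 * (hyp_coeff n * (1 / (real n + real m)))"
proof -
  have upper: "T (Suc n) = (real n - real m) * hyp_coeff n
      + (real m + 1/4) * (real m + 3/4) * (hyp_coeff n * (1 / (real n + real m + 1)))"
  proof -
    have "T (Suc n) = (real n + 1/4) * (real n + 3/4) * hyp_coeff n / (real n + real m + 1)"
      using hyp_coeff_Suc[of n] by (simp add: T_def add_ac)
    moreover have "real n + real m + 1 \<noteq> 0" by linarith
    ultimately show ?thesis
      by (simp add: divide_simps) (simp add: algebra_simps)
  qed
  have lower: "T n = (real n - real m) * hyp_coeff n
      + (real m)\<^sup>2 * (hyp_coeff n * (1 / (real n + real m)))"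
  proof (cases "n + m = 0")
    case False
    then have "real n + real m \<noteq> 0" by linarith
    then show ?thesis
      by (simp add: T_def divide_simps) (simp add: algebra_simps power2_eq_square)
  qed (simp add: T_def)
  show ?thesis using upper lower by simp
qed

lemma hyp_moment_difference_sums:
  "(\<lambda>n. (real m + 1/4) * (real m + 3/4) * (hyp_coeff n * (1 / (real n + real m + 1)))
        - (real m)\<^sup>2 * (hyp_coeff n * (1 / (real n + real m)))) sums (1 / (pi * sqrt 2))"
proof -
  define T where "T = (\<lambda>n. (real n)\<^sup>2 * hyp_coeff n / (real n + real m))"
  have "(\<lambda>n. T (Suc n)) \<longlonglongrightarrow> 1 / (pi * sqrt 2)"
  proof (rule Lim_transform_eventually)
    have "(\<lambda>n. real n / real (n + (m + 1))) \<longlonglongrightarrow> 1"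
      by real_asymp
    from tendsto_mult[OF hyp_coeff_LIMSEQ this]
    show "(\<lambda>n. (real n + 1/4) * (real n + 3/4) * hyp_coeff n / real n
                 * (real n / real (n + (m + 1)))) \<longlonglongrightarrow> 1 / (pi * sqrt 2)"
      by simp
    show "\<forall>\<^sub>F n in sequentially. (real n + 1/4) * (real n + 3/4) * hyp_coeff n / real n
                 * (real n / real (n + (m + 1))) = T (Suc n)"
      using eventually_gt_at_top[of 0]
    proof eventually_elim
      case (elim n)
      then show ?case
        using hyp_coeff_Suc[of n] by (simp add: T_def add_ac)
    qed
  qed
  then have "T \<longlonglongrightarrow> 1 / (pi * sqrt 2)"
    by (simp only: filterlim_sequentially_Suc)
  from telescope_sums[OF this] have "(\<lambda>n. T (Suc n) - T n) sums (1 / (pi * sqrt 2))"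
    by (simp add: T_def)
  then show ?thesis
    by (simp only: T_def hyp_moment_telescope)
qed

text \<open>
  Convergence needs no estimate: the telescoping series converges, at \<open>m = 0\<close> it is a multiple
  of the moment series itself, and at \<open>m + 1\<close> adding a multiple of the previous moment series
  cancels its second part.
\<close>
lemma hyp_moment_sums:
  "(\<lambda>n. hyp_coeff n * (1 / (real n + real m + 1))) sums
     (1 / (pi * sqrt 2) / ((real m + 1/4) * (real m + 3/4) * hyp_coeff m)
        * (\<Sum>j=0..m. hyp_coeff j))"
proof (induction m)
  case 0
  have "(\<lambda>n. 3/16 * (hyp_coeff n * (1 / (real n + 1)))) sums (3/16 * (16 / (3 * (pi * sqrt 2))))"
    using hyp_moment_difference_sums[of 0] by simp
  then have "(\<lambda>n. hyp_coeff n * (1 / (real n + 1))) sums (16 / (3 * (pi * sqrt 2)))"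
    by (subst (asm) sums_mult_iff) simp_all
  then show ?case
    by (simp add: mult_ac)
next
  case (Suc m)
  define c where "c = 1 / (pi * sqrt 2)"
  define q where "q = (real m + 1/4) * (real m + 3/4)"
  define q' where "q' = (real (Suc m) + 1/4) * (real (Suc m) + 3/4)"
  define A where "A = (\<Sum>j=0..m. hyp_coeff j)"
  have q: "q > 0" and q': "q' > 0"
    by (simp_all add: q_def q'_def)
  have a: "hyp_coeff m > 0" and a': "hyp_coeff (Suc m) > 0"
    by (rule hyp_coeff_pos)+
  have rec: "(real (Suc m))\<^sup>2 * hyp_coeff (Suc m) = q * hyp_coeff m"
    using hyp_coeff_Suc[of m] by (simp add: q_def add_ac)
  have prev: "(\<lambda>n. hyp_coeff n * (1 / (real n + real (Suc m)))) sums (c / (q * hyp_coeff m) * A)"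
    using Suc.IH by (simp add: c_def q_def A_def add_ac)
  have "(\<lambda>n. q' * (hyp_coeff n * (1 / (real n + real (Suc m) + 1)))) sums
          (c + (real (Suc m))\<^sup>2 * (c / (q * hyp_coeff m) * A))"
    using sums_add[OF hyp_moment_difference_sums[of "Suc m"]
                      sums_mult[OF prev, of "(real (Suc m))\<^sup>2"]]
    by (simp only: c_def q'_def diff_add_cancel)
  also have "(real (Suc m))\<^sup>2 * (c / (q * hyp_coeff m) * A) = c / hyp_coeff (Suc m) * A"
    using a' by (simp add: rec [symmetric])
  also have "c + c / hyp_coeff (Suc m) * A = c / hyp_coeff (Suc m) * (A + hyp_coeff (Suc m))"
    using a' by (simp add: field_simps)
  finally have "(\<lambda>n. q' * (hyp_coeff n * (1 / (real n + real (Suc m) + 1)))) sums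
      (c / hyp_coeff (Suc m) * (A + hyp_coeff (Suc m)))" .
  from sums_mult[OF this, of "1 / q'"] q' show ?case
    by (simp add: c_def q'_def A_def mult_ac)
qed

lemma moment_prefactor_eq:
  "(16 * sqrt 2 * 64 ^ m)
     / (pi * (2 * real m + 1) * (4 * real m + 3)
          * real ((2*m) choose m) * real ((4*m+2) choose (2*m+1)))
   = 1 / (pi * sqrt 2) / ((real m + 1/4) * (real m + 3/4) * hyp_coeff m)"
proof -
  have odd: "real ((4*m+2) choose (2*m+1))
               = 2 * (4 * real m + 1) / (2 * real m + 1) * real ((4*m) choose (2*m))"
  proof -
    have eqs: "4*m + 2 = 2 * Suc (2*m)" "2*m + 1 = Suc (2*m)"
      by simp_all
    show ?thesis
      unfolding eqs central_binomial_Suc by simp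
  qed
  have pos: "2 * real m + 1 \<noteq> 0" "4 * real m + 1 \<noteq> 0" "4 * real m + 3 \<noteq> 0"
    by linarith+
  have quarters: "real m + 1/4 = (4 * real m + 1) / 4" "real m + 3/4 = (4 * real m + 3) / 4"
    by simp_all
  show ?thesis
    unfolding odd hyp_coeff_def quarters using pos
    by (simp add: divide_simps) (simp flip: mult.assoc)
qed

theorem theorem3p1:
  fixes m :: nat
  shows "(\<lambda>n::nat. 1 / 64 ^ n * real ((2*n) choose n) * real ((4*n) choose (2*n))
            * (1 / (real n + real m + 1)))
         sums
         ((16 * sqrt 2 * 64 ^ m)
            / (pi * (2 * real m + 1) * (4 * real m + 3)
                 * real ((2*m) choose m) * real ((4*m+2) choose (2*m+1)))
          * (\<Sum>j=0..m. 1 / 64 ^ j * real ((2*j) choose j) * real ((4*j) choose (2*j))))"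
  using hyp_moment_sums[of m] unfolding moment_prefactor_eq hyp_coeff_def .

end
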